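(* For all integers $k\ge0$, $|A_{\mathbb{Z}[i],2k+1}|=14\cdot 4^{k+1}-34\cdot 2^{k+1}+8k+29$. For all integers $k\ge1$, $|A_{\mathbb{Z}[i],2k}|=28\cdot 4^{k}-48\cdot 2^{k}+8k+25$.
   Context: For $M\subseteq\mathbb{Z}[i]$ and $\beta\in\mathbb{Z}[i]$, write $M\twoheadrightarrow \mathbb{Z}[i]/\beta$ if every residue class of $\mathbb{Z}[i]/(\beta)$ has a representative in $M$. The Motzkin sets of $\mathbb{Z}[i]$ are $A_{\mathbb{Z}[i],0}=\{0,\pm1,\pm i\}$ and, for $j\ge1$, $A_{\mathbb{Z}[i],j}=A_{\mathbb{Z}[i],j-1}\cup\{\beta\in\mathbb{Z}[i]: A_{\mathbb{Z}[i],j-1}\twoheadrightarrow\mathbb{Z}[i]/\beta\}$. *)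

theory Defs
  imports Complex_Main
begin

definition gauss_ints :: "complex set" where
  "gauss_ints = {z. Re z \<in> \<int> \<and> Im z \<in> \<int>}"

definition gauss_cong :: "complex \<Rightarrow> (complex \<times> complex) set" where
  "gauss_cong \<beta> = {(x, y). x \<in> gauss_ints \<and> y \<in> gauss_ints \<and>
     (\<exists>q\<in>gauss_ints. x - y = \<beta> * q)}"

lemma equiv_gauss_cong: "equiv gauss_ints (gauss_cong \<beta>)"
proof (rule equivI)
  show "gauss_cong \<beta> \<subseteq> gauss_ints \<times> gauss_ints"
    by (auto simp: gauss_cong_def)
  show "refl_on gauss_ints (gauss_cong \<beta>)"
    by (auto simp: refl_on_def gauss_cong_def gauss_ints_def intro!: exI[of _ 0] bexI[of _ 0])
  show "sym (gauss_cong \<beta>)"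
  proof (rule symI)
    fix x y assume "(x, y) \<in> gauss_cong \<beta>"
    then obtain q where q: "x \<in> gauss_ints" "y \<in> gauss_ints" "q \<in> gauss_ints" "x - y = \<beta> * q"
      by (auto simp: gauss_cong_def)
    have "- q \<in> gauss_ints" using q(3) by (simp add: gauss_ints_def)
    moreover have "y - x = \<beta> * (- q)" using q(4) by (simp add: algebra_simps)
    ultimately show "(y, x) \<in> gauss_cong \<beta>" using q(1,2) unfolding gauss_cong_def by blast
  qed
  show "trans (gauss_cong \<beta>)"
  proof (rule transI)
    fix x y z assume "(x, y) \<in> gauss_cong \<beta>" "(y, z) \<in> gauss_cong \<beta>"
    then obtain q r where q: "x \<in> gauss_ints" "z \<in> gauss_ints" "q \<in> gauss_ints" "r \<in> gauss_ints"
      "x - y = \<beta> * q" "y - z = \<beta> * r"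
      by (auto simp: gauss_cong_def)
    have "q + r \<in> gauss_ints" using q by (simp add: gauss_ints_def)
    moreover have "x - z = \<beta> * (q + r)" using q(5,6) by (simp add: algebra_simps)
    ultimately show "(x, z) \<in> gauss_cong \<beta>" using q(1,2) unfolding gauss_cong_def by blast
  qed
qed

definition covers_residues :: "complex set \<Rightarrow> complex \<Rightarrow> bool" where
  "covers_residues M \<beta> \<longleftrightarrow> (\<forall>C \<in> gauss_ints // gauss_cong \<beta>. \<exists>m\<in>M. m \<in> C)"

lemma covers_residues_iff:
  "covers_residues M \<beta> \<longleftrightarrow>
     (\<forall>x\<in>gauss_ints. \<exists>m\<in>M. m \<in> gauss_ints \<and> (\<exists>q\<in>gauss_ints. x - m = \<beta> * q))"
  by (auto simp: covers_residues_def quotient_def gauss_cong_def)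

fun motzkin_set :: "nat \<Rightarrow> complex set" where
  "motzkin_set 0 = {0, 1, -1, \<i>, -\<i>}"
| "motzkin_set (Suc j) =
     motzkin_set j \<union> {\<beta> \<in> gauss_ints. covers_residues (motzkin_set j) \<beta>}"

end

theory Submission
  imports Defs
begin

text \<open>
  Let \<open>w (2 k) = 3 * 2 ^ k\<close> and \<open>w (2 k + 1) = 4 * 2 ^ k\<close>. A Gaussian integer \<open>x + y \<i>\<close> not
  divisible by 2 lies in the \<open>n\<close>-th Motzkin set iff it lies in the octagon
  \<open>\<bar>x\<bar>, \<bar>y\<bar> \<le> w n - 2\<close>, \<open>\<bar>x\<bar> + \<bar>y\<bar> \<le> w (n + 1) - 3\<close>, and \<open>2 \<gamma>\<close> lies in it iff \<open>\<gamma>\<close> lies in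
  the set with index \<open>n - 2\<close> (iff \<open>\<gamma> = 0\<close> when \<open>n < 2\<close>). Counting lattice points then gives the
  cardinalities.

  If the \<open>n\<close>-th set covers the residues modulo \<open>\<beta>\<close>, then the residue next to \<open>(1 + \<i>) \<beta> / 2\<close>,
  whose representatives are all large, forces \<open>\<beta>\<close> into the next octagon; for even \<open>\<beta>\<close> one
  descends by looking only at even residues. Conversely, if \<open>\<beta> \<noteq> 0\<close> is in the next set, all
  Gaussian integers in the square with vertices \<open>\<i> ^ k * (1 + \<i>) \<beta> / 2\<close> lie in the octagon, so
  every residue has a representative \<open>r\<close> there. It can only fail to be in the set when it is even;
  if \<open>\<beta>\<close> is not divisible by 2, moving \<open>r\<close> by an associate of \<open>\<beta>\<close> then gives an element of the
  octagon that is not divisible by 2, and for even \<open>\<beta>\<close> the even residues are covered by induction.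
\<close>

section \<open>Octagons and the explicit form of the Motzkin sets\<close>

fun width :: "nat \<Rightarrow> int" where
  "width 0 = 3"
| "width (Suc 0) = 4"
| "width (Suc (Suc n)) = 2 * width n"

definition octagon :: "nat \<Rightarrow> int \<Rightarrow> int \<Rightarrow> bool" where
  "octagon n x y \<longleftrightarrow> \<bar>x\<bar> \<le> width n - 2 \<and> \<bar>y\<bar> \<le> width n - 2 \<and> \<bar>x\<bar> + \<bar>y\<bar> \<le> width (Suc n) - 3"

fun in_motzkin :: "nat \<Rightarrow> int \<Rightarrow> int \<Rightarrow> bool" where
  "in_motzkin 0 x y = (if even x \<and> even y then x = 0 \<and> y = 0 else octagon 0 x y)"
| "in_motzkin (Suc 0) x y = (if even x \<and> even y then x = 0 \<and> y = 0 else octagon (Suc 0) x y)"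
| "in_motzkin (Suc (Suc n)) x y =
     (if even x \<and> even y then in_motzkin n (x div 2) (y div 2) else octagon (Suc (Suc n)) x y)"

text \<open>For \<beta> = a + b \<i>, the arguments of \<open>M\<close> are the coordinates of x + y
  \<i> - \<beta> (d + e \<i>).\<close>

definition covers :: "(int \<Rightarrow> int \<Rightarrow> bool) \<Rightarrow> int \<Rightarrow> int \<Rightarrow> bool" where
  "covers M a b \<longleftrightarrow> (\<forall>x y. \<exists>d e. M (x - (a * d - b * e)) (y - (a * e + b * d)))"

lemma width_div:
  "width n = (if even n then 3 else 4) * 2 ^ (n div 2)"
  by (induction n rule: width.induct) auto

lemma width_cases:
  obtains (even) "even n" "width n = 3 * 2 ^ (n div 2)" "width (Suc n) = 4 * 2 ^ (n div 2)"
  | (odd) "odd n" "width n = 4 * 2 ^ (n div 2)" "width (Suc n) = 6 * 2 ^ (n div 2)"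
  by (cases "even n") (auto simp: width_div)

lemma width_le_Suc: "width n \<le> width (Suc n)"
  by (rule width_cases[of n]) auto

lemma octagon_Suc: "octagon n x y \<Longrightarrow> octagon (Suc n) x y"
  using width_le_Suc[of n] width_le_Suc[of "Suc n"] unfolding octagon_def by linarith

lemma in_motzkin_zero [simp]: "in_motzkin n 0 0"
  by (induction n rule: width.induct) auto

lemma in_motzkin_not_even: "\<not> (even x \<and> even y) \<Longrightarrow> in_motzkin n x y \<longleftrightarrow> octagon n x y"
  by (cases "(n, x, y)" rule: in_motzkin.cases) auto

lemma in_motzkin_Suc: "in_motzkin n x y \<Longrightarrow> in_motzkin (Suc n) x y"
proof (induction n x y rule: in_motzkin.induct)
  case (1 x y)
  then show ?case using octagon_Suc[of 0 x y] by (auto split: if_splits)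
next
  case (2 x y)
  then show ?case using octagon_Suc[of "Suc 0" x y] by (auto split: if_splits)
next
  case (3 n x y)
  then show ?case using octagon_Suc[of "Suc (Suc n)" x y]
    by (cases "even x \<and> even y") auto
qed

lemma in_motzkin_octagon: "in_motzkin n x y \<Longrightarrow> octagon n x y"
proof (induction n x y rule: in_motzkin.induct)
  case (3 n x y)
  show ?case
  proof (cases "even x \<and> even y")
    case True
    then obtain p q where "x = 2 * p" "y = 2 * q" by (elim conjE evenE)
    then show ?thesis using 3 by (simp add: octagon_def abs_mult)
  next
    case False
    then show ?thesis using 3 by (simp add: in_motzkin_not_even)
  qed
qed (auto simp: octagon_def split: if_splits)

section \<open>Symmetry under rotation and conjugation\<close>

lemma octagon_rot: "octagon n (- y) x \<longleftrightarrow> octagon n x y"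
  by (auto simp: octagon_def)

lemma octagon_conj: "octagon n x (- y) \<longleftrightarrow> octagon n x y"
  by (auto simp: octagon_def)

lemma uminus_div_2: "even x \<Longrightarrow> - x div 2 = - (x div (2::int))"
  by (auto elim!: evenE)

lemma in_motzkin_rot: "in_motzkin n (- y) x \<longleftrightarrow> in_motzkin n x y"
  by (induction n x y rule: in_motzkin.induct) (auto simp: octagon_rot uminus_div_2)

lemma in_motzkin_conj: "in_motzkin n x (- y) \<longleftrightarrow> in_motzkin n x y"
  by (induction n x y rule: in_motzkin.induct) (auto simp: octagon_conj uminus_div_2)

text \<open>\<beta> and \<i> \<beta> generate the same ideal; the quotient d + e \<i> turns into e -
  d \<i>.\<close>

lemma covers_rot:
  assumes "covers M a b"
  shows "covers M (- b) a"
  unfolding covers_def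
proof (intro allI)
  fix x y
  obtain d e where "M (x - (a * d - b * e)) (y - (a * e + b * d))"
    using assms unfolding covers_def by blast
  then show "\<exists>d e. M (x - (- b * d - a * e)) (y - (- b * e + a * d))"
    by (intro exI[of _ e] exI[of _ "- d"]) (simp add: algebra_simps)
qed

text \<open>Conjugation may change the ideal, so here the symmetry of \<open>M\<close> itself
  enters.\<close>

lemma covers_conj:
  assumes "covers M a b" and M: "\<And>x y. M x (- y) \<longleftrightarrow> M x y"
  shows "covers M a (- b)"
  unfolding covers_def
proof (intro allI)
  fix x y
  obtain d e where "M (x - (a * d - b * e)) (- y - (a * e + b * d))"
    using assms unfolding covers_def by blast
  then show "\<exists>d e. M (x - (a * d - - b * e)) (y - (a * e + - b * d))"
    using M[of "x - (a * d - b * e)" "- y - (a * e + b * d)"]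
    by (intro exI[of _ d] exI[of _ "- e"]) (simp add: algebra_simps)
qed

lemma quadrant_wlog:
  fixes P :: "int \<Rightarrow> int \<Rightarrow> bool"
  assumes rot: "\<And>a b. P a b \<Longrightarrow> P (- b) a"
    and quadrant: "\<And>a b. 0 \<le> a \<Longrightarrow> 0 \<le> b \<Longrightarrow> P a b"
  shows "P a b"
proof -
  have r: "P a b" if "P b (- a)" for a b using rot[OF that] by simp
  consider "0 \<le> a" "0 \<le> b" | "0 \<le> b" "0 \<le> - a" | "0 \<le> - a" "0 \<le> - b" | "0 \<le> - b" "0 \<le> a"
    by linarith
  then show ?thesis
  proof cases
    case 2 then show ?thesis by (intro r[OF quadrant])
  next
    case 3 then show ?thesis by (intro r[OF r[OF quadrant]])
  next
    case 4
    then have "P (- b) a" by (intro quadrant)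
    from rot[OF rot[OF rot[OF this]]] show ?thesis by simp
  qed (rule quadrant)
qed

lemma octant_wlog:
  fixes P :: "int \<Rightarrow> int \<Rightarrow> bool"
  assumes rot: "\<And>a b. P a b \<Longrightarrow> P (- b) a"
    and conj: "\<And>a b. P a b \<Longrightarrow> P a (- b)"
    and octant: "\<And>a b. 0 \<le> b \<Longrightarrow> b \<le> a \<Longrightarrow> P a b"
  shows "P a b"
proof (rule quadrant_wlog[of P, OF rot])
  fix a b :: int assume ab: "0 \<le> a" "0 \<le> b"
  show "P a b"
  proof (cases "b \<le> a")
    case False
    then have "P b a" using ab by (intro octant) simp_all
    from rot[OF conj[OF this]] show ?thesis by simp
  qed (simp add: octant ab)
qed

section \<open>Reduction of residues into the octagon\<close>

lemma div_round:
  fixes z N :: int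
  assumes "0 < N"
  shows "\<exists>d. 2 * \<bar>z - N * d\<bar> \<le> N"
proof
  define d where "d = (2 * z + N) div (2 * N)"
  have "2 * N * d + (2 * z + N) mod (2 * N) = 2 * z + N" unfolding d_def by (rule mult_div_mod_eq)
  moreover have "0 \<le> (2 * z + N) mod (2 * N)" "(2 * z + N) mod (2 * N) < 2 * N" using assms by auto
  ultimately have "2 * (z - N * d) \<le> N" "- N \<le> 2 * (z - N * d)" by (simp_all add: algebra_simps)
  then show "2 * \<bar>z - N * d\<bar> \<le> N" by linarith
qed

text \<open>A residue modulo \<open>\<beta> = a + b \<i>\<close> is reduced to the square with vertices
  \<open>\<i> ^ k * (1 + \<i>) * \<beta> / 2\<close>; the bounds are read off at the vertices. For odd \<open>a + b\<close> the
  vertices are not Gaussian integers, which makes the last bound strict.\<close>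
lemma reduce_to_square:
  fixes a b x y :: int
  assumes "0 \<le> b" "b \<le> a" "0 < a"
  shows "\<exists>d e u v. u = x - (a * d - b * e) \<and> v = y - (a * e + b * d) \<and>
    2 * \<bar>u\<bar> \<le> a + b \<and> 2 * \<bar>v\<bar> \<le> a + b \<and> \<bar>u\<bar> + \<bar>v\<bar> \<le> a \<and> (odd (a + b) \<longrightarrow> \<bar>u\<bar> + \<bar>v\<bar> < a)"
proof -
  define N where "N = a * a + b * b"
  have N: "0 < N" using assms unfolding N_def by (simp add: add_pos_nonneg)
  \<comment> \<open>With z = x + y \<i>, the numbers a x + b y and a y - b x are the coordinates of
    z times the conjugate of \<beta>, so d + e \<i> is a Gaussian integer nearest to z /
    \<beta>.\<close>
  obtain d where d: "2 * \<bar>(a * x + b * y) - N * d\<bar> \<le> N" using div_round[OF N] by blast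
  obtain e where e: "2 * \<bar>(a * y - b * x) - N * e\<bar> \<le> N" using div_round[OF N] by blast
  define u v where "u = x - (a * d - b * e)" and "v = y - (a * e + b * d)"
  define p q where "p = a * u + b * v" and "q = a * v - b * u"
  have pq: "2 * \<bar>p\<bar> \<le> N" "2 * \<bar>q\<bar> \<le> N"
    using d e unfolding p_def q_def u_def v_def N_def by (simp_all add: algebra_simps)
  have u: "N * u = a * p - b * q" and v: "N * v = b * p + a * q"
    unfolding N_def p_def q_def by (simp_all add: algebra_simps)
  have bound: "\<bar>s * p + t * q\<bar> * 2 \<le> (\<bar>s\<bar> + \<bar>t\<bar>) * M"
    if "2 * \<bar>p\<bar> \<le> M" "2 * \<bar>q\<bar> \<le> M" for s t M
  proof -
    have "\<bar>s * p + t * q\<bar> \<le> \<bar>s\<bar> * \<bar>p\<bar> + \<bar>t\<bar> * \<bar>q\<bar>"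
      by (metis abs_triangle_ineq abs_mult)
    moreover have "\<bar>s\<bar> * (2 * \<bar>p\<bar>) \<le> \<bar>s\<bar> * M" "\<bar>t\<bar> * (2 * \<bar>q\<bar>) \<le> \<bar>t\<bar> * M"
      using that by (auto intro: mult_left_mono)
    ultimately show ?thesis by (simp add: algebra_simps)
  qed
  have bound': "\<bar>w\<bar> * 2 * N \<le> (\<bar>s\<bar> + \<bar>t\<bar>) * M"
    if "2 * \<bar>p\<bar> \<le> M" "2 * \<bar>q\<bar> \<le> M" "N * w = s * p + t * q" for s t M w
  proof -
    have "\<bar>w\<bar> * 2 * N = \<bar>s * p + t * q\<bar> * 2"
      unfolding that(3)[symmetric] using N by (simp add: abs_mult)
    also have "\<dots> \<le> (\<bar>s\<bar> + \<bar>t\<bar>) * M" by (rule bound[OF that(1,2)])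
    finally show ?thesis .
  qed
  have le: "\<bar>w\<bar> * 2 \<le> \<bar>s\<bar> + \<bar>t\<bar>" if "N * w = s * p + t * q" for w s t
    using bound'[OF pq that] N by (simp add: mult_le_cancel_right)
  \<comment> \<open>For odd N the even numbers 2 |p| and 2 |q| cannot reach N.\<close>
  have less: "\<bar>w\<bar> * 2 < \<bar>s\<bar> + \<bar>t\<bar>" if "N * w = s * p + t * q" "odd N" "0 < \<bar>s\<bar> + \<bar>t\<bar>" for w s t
  proof -
    have "2 * \<bar>p\<bar> \<le> N - 1" "2 * \<bar>q\<bar> \<le> N - 1"
      using pq \<open>odd N\<close> by presburger+
    from bound'[OF this that(1)] have "\<bar>w\<bar> * 2 * N < (\<bar>s\<bar> + \<bar>t\<bar>) * N"
      using that(3) by (simp add: algebra_simps)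
    then show ?thesis using N by (simp add: mult_less_cancel_right)
  qed
  \<comment> \<open>|u| + |v| is the larger of |u + v| and |u - v|, and both are linear in p and
    q.\<close>
  have sum: "N * (u + v) = (a + b) * p + (a - b) * q" and diff: "N * (u - v) = (a - b) * p + (- a - b) * q"
    using u v by (simp_all add: algebra_simps)
  show ?thesis
  proof (intro exI conjI impI)
    show "u = x - (a * d - b * e)" "v = y - (a * e + b * d)" by (fact u_def v_def)+
    show "2 * \<bar>u\<bar> \<le> a + b" using le[of u a "- b"] u assms by simp
    show "2 * \<bar>v\<bar> \<le> a + b" using le[of v b a] v assms by simp
    have *: "\<bar>a + b\<bar> = a + b" "\<bar>a - b\<bar> = a - b" "\<bar>- a - b\<bar> = a + b" using assms by auto
    show "\<bar>u\<bar> + \<bar>v\<bar> \<le> a" using le[OF sum] le[OF diff] unfolding * by (simp add: abs_if split: if_splits)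
    assume "odd (a + b)"
    then have "odd N" unfolding N_def by auto
    then show "\<bar>u\<bar> + \<bar>v\<bar> < a" using less[OF sum] less[OF diff] assms(3) unfolding *
      by (simp add: abs_if split: if_splits)
  qed
qed

text \<open>The square of \<beta> fits, except that a = \<open>width (Suc n) - 2\<close> might allow
  a coordinate sum one too large. Parity rules this out: either a + b is odd and the bound is
  strict, or a and b are both odd while \<open>width (Suc n)\<close> is even.\<close>

lemma covers_octagon_odd:
  assumes "octagon (Suc n) a b" "\<not> (even a \<and> even b)"
  shows "covers (octagon n) a b"
proof -
  have "octagon (Suc n) a b \<and> \<not> (even a \<and> even b) \<longrightarrow> covers (octagon n) a b" for a b
  proof (induction a b rule: octant_wlog)
    case (1 a b)
    then show ?case using covers_rot[of "octagon n" a b] octagon_rot[of "Suc n" b a] by auto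
  next
    case (2 a b)
    then show ?case using covers_conj[of "octagon n" a b] by (auto simp: octagon_conj)
  next
    case (3 a b)
    show ?case
    proof
      assume ab: "octagon (Suc n) a b \<and> \<not> (even a \<and> even b)"
      then have "0 < a" using 3 by (cases "a = 0") auto
      have le: "a \<le> width (Suc n) - 2" "a + b \<le> 2 * width n - 3"
        using ab 3 by (auto simp: octagon_def)
      have ev: "even (width (Suc n))" by (simp add: width_div)
      show "covers (octagon n) a b" unfolding covers_def
      proof (intro allI)
        fix x y
        from 3 \<open>0 < a\<close> obtain d e u v where uv: "u = x - (a * d - b * e)" "v = y - (a * e + b * d)"
          "2 * \<bar>u\<bar> \<le> a + b" "2 * \<bar>v\<bar> \<le> a + b" "\<bar>u\<bar> + \<bar>v\<bar> \<le> a"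
          "odd (a + b) \<Longrightarrow> \<bar>u\<bar> + \<bar>v\<bar> < a"
          using reduce_to_square[of b a x y] by blast
        have "\<bar>u\<bar> + \<bar>v\<bar> \<le> width (Suc n) - 3"
        proof (cases "odd (a + b)")
          case True
          then show ?thesis using uv(6) le by linarith
        next
          case False
          then have "odd a" using ab by auto
          then have "a \<noteq> width (Suc n) - 2" using ev by auto
          then show ?thesis using uv(5) le by linarith
        qed
        then have "octagon n u v" using uv(3,4) le unfolding octagon_def by linarith
        then show "\<exists>d e. octagon n (x - (a * d - b * e)) (y - (a * e + b * d))"
          using uv(1,2) by blast
      qed
    qed
  qed
  then show ?thesis using assms by blast
qed

text \<open>For 2 \<gamma> the square gives |u|, |v| \<le> a + b and |u| + |v| \<le> 2 a when 0
  \<le> b \<le> a. So the diagonal bound on \<gamma> controls the coordinates and the coordinate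
  bound controls the sum, each with one unit to spare.\<close>

lemma covers_octagon_double:
  assumes "octagon n a b" "a \<noteq> 0 \<or> b \<noteq> 0"
  shows "covers (octagon (Suc n)) (2 * a) (2 * b)"
proof -
  have "octagon n a b \<and> (a \<noteq> 0 \<or> b \<noteq> 0) \<longrightarrow> covers (octagon (Suc n)) (2 * a) (2 * b)" for a b
  proof (induction a b rule: octant_wlog)
    case (1 a b)
    then show ?case using covers_rot[of "octagon (Suc n)" "2 * a" "2 * b"] octagon_rot[of n b a] by auto
  next
    case (2 a b)
    then show ?case using covers_conj[of "octagon (Suc n)" "2 * a" "2 * b"] by (auto simp: octagon_conj)
  next
    case (3 a b)
    show ?case
    proof
      assume ab: "octagon n a b \<and> (a \<noteq> 0 \<or> b \<noteq> 0)"
      then have pos: "0 \<le> 2 * b" "2 * b \<le> 2 * a" "0 < 2 * a" using 3 by auto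
      have le: "a \<le> width n - 2" "a + b \<le> width (Suc n) - 3"
        using ab 3 by (auto simp: octagon_def)
      show "covers (octagon (Suc n)) (2 * a) (2 * b)" unfolding covers_def
      proof (intro allI)
        fix x y
        from pos obtain d e u v where uv: "u = x - (2 * a * d - 2 * b * e)" "v = y - (2 * a * e + 2 * b * d)"
          "2 * \<bar>u\<bar> \<le> 2 * a + 2 * b" "2 * \<bar>v\<bar> \<le> 2 * a + 2 * b" "\<bar>u\<bar> + \<bar>v\<bar> \<le> 2 * a"
          using reduce_to_square[of "2 * b" "2 * a" x y] by auto
        then have "octagon (Suc n) u v" using le unfolding octagon_def width.simps by linarith
        then show "\<exists>d e. octagon (Suc n) (x - (2 * a * d - 2 * b * e)) (y - (2 * a * e + 2 * b * d))"
          using uv(1,2) by blast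
      qed
    qed
  qed
  then show ?thesis using assms by blast
qed

section \<open>Covering of residues modulo elements of the next set\<close>

lemma octagon_linear:
  "octagon n x y \<longleftrightarrow> x \<le> width n - 2 \<and> - x \<le> width n - 2 \<and> y \<le> width n - 2 \<and> - y \<le> width n - 2 \<and>
    x + y \<le> width (Suc n) - 3 \<and> x - y \<le> width (Suc n) - 3 \<and>
    - x + y \<le> width (Suc n) - 3 \<and> - x - y \<le> width (Suc n) - 3"
  unfolding octagon_def by linarith

text \<open>The recursion strips common factors 2. Let t be their product when an octagon bound
  fails; scaled back by t, the failing bound is the first alternative. The second is a nonzero even
  pair reached at index 1. At index 0 such a pair already violates the octagon.\<close>

lemma not_in_motzkin_scale:
  assumes "\<not> in_motzkin n x y"
  shows "(\<exists>t>0. t dvd 2 ^ (n div 2) \<and> t dvd x \<and> t dvd y \<and>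
      (width n - 2 * t < \<bar>x\<bar> \<or> width n - 2 * t < \<bar>y\<bar> \<or> width (Suc n) - 3 * t < \<bar>x\<bar> + \<bar>y\<bar>)) \<or>
    odd n \<and> (x \<noteq> 0 \<or> y \<noteq> 0) \<and> 2 * 2 ^ (n div 2) dvd x \<and> 2 * 2 ^ (n div 2) dvd y"
  using assms
proof (induction n x y rule: in_motzkin.induct)
  case (1 x y)
  then show ?case by (cases "even x \<and> even y") (auto simp: octagon_def intro!: exI[of _ 1])
next
  case (2 x y)
  then show ?case by (cases "even x \<and> even y") (auto simp: octagon_def numeral_eq_Suc intro!: exI[of _ 1])
next
  case (3 n x y)
  show ?case
  proof (cases "even x \<and> even y")
    case False
    then show ?thesis using 3 by (intro disjI1 exI[of _ 1]) (auto simp: octagon_def)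
  next
    case True
    then obtain p q where pq: "x = 2 * p" "y = 2 * q" by (elim conjE evenE)
    then have "\<not> in_motzkin n p q" using 3 by simp
    with 3 True pq consider
      t where "t > 0" "t dvd 2 ^ (n div 2)" "t dvd p" "t dvd q"
        "width n - 2 * t < \<bar>p\<bar> \<or> width n - 2 * t < \<bar>q\<bar> \<or> width (Suc n) - 3 * t < \<bar>p\<bar> + \<bar>q\<bar>"
      | "odd n" "p \<noteq> 0 \<or> q \<noteq> 0" "2 * 2 ^ (n div 2) dvd p" "2 * 2 ^ (n div 2) dvd q"
      by auto
    then show ?thesis
    proof cases
      case (1 t)
      then show ?thesis unfolding pq by (intro disjI1 exI[of _ "2 * t"]) (auto simp: abs_mult)
    next
      case 2
      then show ?thesis unfolding pq by (intro disjI2) auto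
    qed
  qed
qed

text \<open>If the representative \<open>r = x + y \<i>\<close> fails because of divisibility by a power \<open>t\<close> of two,
  then it lies within \<open>2 t\<close> of the boundary, and one of \<open>r - \<beta>\<close> and \<open>r - \<i> * \<beta>\<close> is again in the octagon.\<close>
lemma octagon_step:
  assumes r: "octagon n x y" "0 \<le> x" "0 \<le> y" "\<not> in_motzkin n x y"
    and \<beta>: "octagon (Suc n) a b" "0 \<le> b" "b \<le> a" "\<not> (even a \<and> even b)"
  shows "octagon n (x - a) (y - b) \<or> octagon n (x + b) (y - a)"
proof -
  define T :: int where "T = 2 ^ (n div 2)"
  have T: "0 < T" by (simp add: T_def)
  note oct = r(1)[unfolded octagon_linear] \<beta>(1)[unfolded octagon_linear width.simps]
  \<comment> \<open>If b = y - x and x, y \<le> a, both candidates have coordinate sum a, one too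
    many for a = \<open>width (Suc n) - 2\<close>. But x and y are even, so b and that a would both
    be even.\<close>
  have h: "b = y - x \<Longrightarrow> a \<noteq> width (Suc n) - 2"
    using \<beta>(4) in_motzkin_not_even[of x y n] r(1,4) by (auto simp: width_div)
  have gap: "c = 0 \<or> c \<le> - t" if "t dvd c" "c \<le> 0" "0 < t" for c t :: int
    using that by (metis dvd_minus_iff le_minus_iff neg_0_less_iff_less order_le_less zdvd_not_zless linorder_not_less)
  from not_in_motzkin_scale[OF r(4)] consider
    t where "t > 0" "t dvd T" "t dvd x" "t dvd y"
      "width n - 2 * t < x \<or> width n - 2 * t < y \<or> width (Suc n) - 3 * t < x + y"
    | "odd n" "x \<noteq> 0 \<or> y \<noteq> 0" "2 * T dvd x" "2 * T dvd y"
    using r by (auto simp: T_def)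
  then show ?thesis
  proof cases
    case (1 t)
    have "t \<le> T" using 1 T by (auto intro: zdvd_imp_le)
    \<comment> \<open>Coordinates and widths are multiples of t, so distances to the sides are too,
      and few positions near the boundary remain.\<close>
    have tw: "t dvd width n" "t dvd width (Suc n)"
      using \<open>t dvd T\<close> by (rule_tac [!] width_cases[of n]) (auto simp: T_def[symmetric])
    have gx: "x \<le> width n - 2 * t \<or> x = width n - t"
      using gap[of t "x - width n + t"] gap[of t "x - width n"] 1 tw oct by auto
    have gy: "y \<le> width n - 2 * t \<or> y = width n - t"
      using gap[of t "y - width n + t"] gap[of t "y - width n"] 1 tw oct by auto
    have gxy: "x + y \<le> width (Suc n) - 3 * t \<or> x + y = width (Suc n) - 2 * t \<or> x + y = width (Suc n) - t"
      using gap[of t "x + y - width (Suc n) + t"] gap[of t "x + y - width (Suc n)"]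
        gap[of t "x + y - width (Suc n) + 2 * t"] 1 tw oct by auto
    show ?thesis
    proof (rule width_cases[of n])
      assume n: "width n = 3 * 2 ^ (n div 2)" "width (Suc n) = 4 * 2 ^ (n div 2)"
      show ?thesis
        using h oct gx gy gxy 1(1,5) \<open>t \<le> T\<close> r(2,3) \<beta>(2,3) unfolding octagon_linear n T_def[symmetric]
        by (smt (verit))
    next
      assume n: "width n = 4 * 2 ^ (n div 2)" "width (Suc n) = 6 * 2 ^ (n div 2)"
      show ?thesis
        using h oct gx gy gxy 1(1,5) \<open>t \<le> T\<close> r(2,3) \<beta>(2,3) unfolding octagon_linear n T_def[symmetric]
        by (smt (verit))
    qed
  next
    case 2
    then have n: "width n = 4 * T" "width (Suc n) = 6 * T" by (auto simp: T_def width_div)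
    have "c = 0 \<or> c = 2 * T" if "2 * T dvd c" "0 \<le> c" "c \<le> 4 * T - 2" for c
      using gap[of "2 * T" "c - 4 * T"] gap[of "2 * T" "c - 2 * T"] that T by auto
    then have "x = 0 \<or> x = 2 * T" "y = 0 \<or> y = 2 * T" using 2 r(2,3) oct n by auto
    then show ?thesis using h oct 2(2) T r(2,3) \<beta>(2,3) unfolding octagon_linear n
      by (smt (verit))
  qed
qed

lemma covers_in_motzkin_odd:
  assumes "octagon (Suc n) a b" "\<not> (even a \<and> even b)"
  shows "covers (in_motzkin n) a b"
proof -
  have "octagon (Suc n) a b \<and> \<not> (even a \<and> even b) \<longrightarrow> covers (in_motzkin n) a b" for a b
  proof (induction a b rule: octant_wlog)
    case (1 a b)
    then show ?case using covers_rot[of "in_motzkin n" a b] octagon_rot[of "Suc n" b a] by auto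
  next
    case (2 a b)
    then show ?case using covers_conj[of "in_motzkin n" a b] by (auto simp: octagon_conj in_motzkin_conj)
  next
    case (3 a b)
    show ?case
    proof
      assume ab: "octagon (Suc n) a b \<and> \<not> (even a \<and> even b)"
      \<comment> \<open>Rotating r = x + y \<i> rotates its whole class modulo \<beta>, so r may be
        taken in the first quadrant, as \<open>octagon_step\<close> requires.\<close>
      have step: "octagon n x y \<longrightarrow> (\<exists>d e. in_motzkin n (x - (a * d - b * e)) (y - (a * e + b * d)))" for x y
      proof (induction x y rule: quadrant_wlog)
        case (1 x y)
        show ?case
        proof
          assume "octagon n (- y) x"
          then obtain d e where "in_motzkin n (x - (a * d - b * e)) (y - (a * e + b * d))"
            using 1 by (auto simp: octagon_rot)
          then have "in_motzkin n (- (y - (a * e + b * d))) (x - (a * d - b * e))"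
            by (simp only: in_motzkin_rot)
          then show "\<exists>d e. in_motzkin n (- y - (a * d - b * e)) (x - (a * e + b * d))"
            by (intro exI[of _ "- e"] exI[of _ d]) (simp add: algebra_simps)
        qed
      next
        case (2 x y)
        show ?case
        proof
          assume oct: "octagon n x y"
          show "\<exists>d e. in_motzkin n (x - (a * d - b * e)) (y - (a * e + b * d))"
          proof (cases "in_motzkin n x y")
            case True
            then show ?thesis by (intro exI[of _ 0]) simp
          next
            case False
            then have "even x" "even y" using oct in_motzkin_not_even by blast+
            \<comment> \<open>As r is divisible by 2 and \<beta> is not, neither shift is, and for
              such elements membership is just the octagon.\<close>
            then have "\<not> (even (x - a) \<and> even (y - b))" "\<not> (even (x + b) \<and> even (y - a))"
              using ab by auto
            with octagon_step[OF oct 2 False _ 3] ab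
            have "in_motzkin n (x - a) (y - b) \<or> in_motzkin n (x + b) (y - a)" by (auto simp: in_motzkin_not_even)
            then show ?thesis
            proof
              assume "in_motzkin n (x - a) (y - b)"
              then show ?thesis by (intro exI[of _ 1] exI[of _ 0]) simp
            next
              assume "in_motzkin n (x + b) (y - a)"
              then show ?thesis by (intro exI[of _ 0] exI[of _ 1]) simp
            qed
          qed
        qed
      qed
      show "covers (in_motzkin n) a b" unfolding covers_def
      proof (intro allI)
        fix x y
        obtain d e where "octagon n (x - (a * d - b * e)) (y - (a * e + b * d))"
          using covers_octagon_odd ab unfolding covers_def by blast
        from step[rule_format, OF this] obtain d' e' where
          "in_motzkin n (x - (a * d - b * e) - (a * d' - b * e')) (y - (a * e + b * d) - (a * e' + b * d'))"
          by blast
        then show "\<exists>d e. in_motzkin n (x - (a * d - b * e)) (y - (a * e + b * d))"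
          by (intro exI[of _ "d + d'"] exI[of _ "e + e'"]) (simp add: algebra_simps)
      qed
    qed
  qed
  then show ?thesis using assms by blast
qed

text \<open>Elements congruent modulo 2 \<gamma> agree modulo 2. Residues not divisible by 2 need
  only a representative in the octagon; for the others, halving turns the task into covering modulo
  \<gamma>.\<close>

lemma covers_in_motzkin_double:
  assumes "octagon n a b" "a \<noteq> 0 \<or> b \<noteq> 0"
    and even: "\<And>x y. \<exists>d e. in_motzkin (Suc n) (2 * (x - (a * d - b * e))) (2 * (y - (a * e + b * d)))"
  shows "covers (in_motzkin (Suc n)) (2 * a) (2 * b)"
  unfolding covers_def
proof (intro allI)
  fix x y
  show "\<exists>d e. in_motzkin (Suc n) (x - (2 * a * d - 2 * b * e)) (y - (2 * a * e + 2 * b * d))"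
  proof (cases "even x \<and> even y")
    case True
    then obtain p q where "x = 2 * p" "y = 2 * q" by (elim conjE evenE)
    then show ?thesis using even[of p q] by (simp add: algebra_simps)
  next
    case False
    obtain d e where "octagon (Suc n) (x - (2 * a * d - 2 * b * e)) (y - (2 * a * e + 2 * b * d))"
      using covers_octagon_double[OF assms(1,2)] unfolding covers_def by blast
    moreover have "\<not> (even (x - (2 * a * d - 2 * b * e)) \<and> even (y - (2 * a * e + 2 * b * d)))"
      using False by simp
    ultimately show ?thesis using in_motzkin_not_even by blast
  qed
qed

lemma in_motzkin_imp_covers:
  assumes "in_motzkin (Suc n) a b" "a \<noteq> 0 \<or> b \<noteq> 0"
  shows "covers (in_motzkin n) a b"
  using assms
proof (induction n arbitrary: a b rule: width.induct)
  case 1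
  then have "\<not> (even a \<and> even b)" by auto
  then show ?case using 1 in_motzkin_octagon covers_in_motzkin_odd by blast
next
  case (2 a b)
  show ?case
  proof (cases "even a \<and> even b")
    case True
    then obtain p q where pq: "a = 2 * p" "b = 2 * q" by (elim conjE evenE)
    have in_motzkin: "in_motzkin 0 p q" using 2 pq by simp
    then have oct: "octagon 0 p q" by (rule in_motzkin_octagon)
    then have "\<bar>p\<bar> + \<bar>q\<bar> \<le> 1" by (simp add: octagon_def)
    then have "p = 0 \<and> \<bar>q\<bar> = 1 \<or> \<bar>p\<bar> = 1 \<and> q = 0" using 2(2) pq by auto
    then have "p * p + q * q = 1" by (auto simp: abs_if split: if_splits)
    show ?thesis unfolding pq
    proof (rule covers_in_motzkin_double[OF oct])
      show "p \<noteq> 0 \<or> q \<noteq> 0" using 2 pq by simp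
      fix x y
      \<comment> \<open>\<gamma> = p + q \<i> is a unit with its conjugate as inverse, so 0
        represents every even residue.\<close>
      have "p * (p * x + q * y) - q * (p * y - q * x) = (p * p + q * q) * x"
        "p * (p * y - q * x) + q * (p * x + q * y) = (p * p + q * q) * y"
        by (simp_all add: algebra_simps)
      then show "\<exists>d e. in_motzkin (Suc 0) (2 * (x - (p * d - q * e))) (2 * (y - (p * e + q * d)))"
        unfolding \<open>p * p + q * q = 1\<close>
        by (intro exI[of _ "p * x + q * y"] exI[of _ "p * y - q * x"]) simp
    qed
  next
    case False
    then show ?thesis using 2 in_motzkin_octagon covers_in_motzkin_odd by blast
  qed
next
  case (3 n a b)
  show ?case
  proof (cases "even a \<and> even b")
    case True
    then obtain p q where pq: "a = 2 * p" "b = 2 * q" by (elim conjE evenE)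
    have in_motzkin: "in_motzkin (Suc n) p q" using 3(2) pq by simp
    have nz: "p \<noteq> 0 \<or> q \<noteq> 0" using 3(3) pq by simp
    show ?thesis unfolding pq
      by (rule covers_in_motzkin_double[OF in_motzkin_octagon[OF in_motzkin] nz]) (use 3(1)[OF in_motzkin nz] in \<open>simp add: covers_def\<close>)
  next
    case False
    then show ?thesis using 3 in_motzkin_octagon covers_in_motzkin_odd by blast
  qed
qed

section \<open>Covering forces membership in the next set\<close>

text \<open>This bounds the sup norm of (p + q \<i>) (u + v \<i>). As u + v is odd, |u| and |v|
  differ; with m the larger, the coordinate where q meets it has size at least q m - p (m - 1) \<ge>
  q.\<close>

lemma odd_multiple_max_norm:
  fixes p q u v :: int
  assumes "0 \<le> p" "p \<le> q" "odd (u + v)"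
  shows "q \<le> max \<bar>p * u - q * v\<bar> \<bar>p * v + q * u\<bar>"
proof -
  have *: "q \<le> \<bar>p * s + q * r\<bar>" if "\<bar>s\<bar> < \<bar>r\<bar>" for r s
  proof -
    have "p * \<bar>s\<bar> \<le> q * (\<bar>r\<bar> - 1)" using that assms by (intro mult_mono) auto
    moreover have "\<bar>q * r\<bar> - \<bar>p * s\<bar> \<le> \<bar>p * s + q * r\<bar>" by linarith
    ultimately show ?thesis using assms by (simp add: abs_mult algebra_simps)
  qed
  have "\<bar>u\<bar> \<noteq> \<bar>v\<bar>" using assms(3) by (auto simp: abs_eq_iff)
  then consider "\<bar>v\<bar> < \<bar>u\<bar>" | "\<bar>u\<bar> < \<bar>- v\<bar>" by linarith
  then show ?thesis using *[of v u] *[of u "- v"] by cases auto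
qed

text \<open>The residue closest to \<open>(1 + \<i>) * \<beta> / 2\<close> has no small representative: up to rounding, the
  elements of its class are the odd multiples of \<open>(1 + \<i>) * \<beta> / 2\<close>.\<close>
lemma covers_imp_octagon:
  assumes "covers (octagon n) a b"
  shows "octagon (Suc n) a b"
proof -
  have "covers (octagon n) a b \<longrightarrow> octagon (Suc n) a b" for a b
  proof (induction a b rule: octant_wlog)
    case (1 a b)
    then show ?case using covers_rot[of "octagon n" "- b" a] covers_rot[of "octagon n" "- a" "- b"]
        covers_rot[of "octagon n" b "- a"] octagon_rot[of "Suc n" b a] by auto
  next
    case (2 a b)
    then show ?case using covers_conj[of "octagon n" a "- b"] by (auto simp: octagon_conj)
  next
    case (3 a b)
    show ?case
    proof
      assume cov: "covers (octagon n) a b"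
      \<comment> \<open>(1 + \<i>) \<beta> = (a - b) + (a + b) \<i>; adding s (1 + \<i>) makes it
        divisible by 2, and half of that is the residue to test.\<close>
      define s where "s = (a + b) mod 2"
      have s: "0 \<le> s" "s \<le> 1" "even (a - b + s)" "even (a + b + s)"
        unfolding s_def by presburger+
      obtain p q where pq: "a - b + s = 2 * p" "a + b + s = 2 * q"
        using s(3,4) by (elim evenE)
      obtain d e where oct: "octagon n (p - (a * d - b * e)) (q - (a * e + b * d))"
        using cov unfolding covers_def by blast
      define x y where "x = p - (a * d - b * e)" and "y = q - (a * e + b * d)"
      \<comment> \<open>2 (x + y \<i>) - s (1 + \<i>) = (1 + \<i>) \<beta> (u + v \<i>), where u + v
        \<i> = 1 - (1 - \<i>) (d + e \<i>); hence u + v = 1 - 2 e is odd.\<close>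
      define u v where "u = 1 - d - e" and "v = d - e"
      have uv: "odd (u + v)" "odd (u + - v)" unfolding u_def v_def by simp_all
      have xy: "2 * x - s = (a - b) * u - (a + b) * v" "2 * y - s = (a - b) * v + (a + b) * u"
        using pq unfolding x_def y_def u_def v_def by (simp_all add: algebra_simps)
      have "a + b \<le> max \<bar>2 * x - s\<bar> \<bar>2 * y - s\<bar>"
        unfolding xy using 3 by (intro odd_multiple_max_norm uv) auto
      then have sup: "a + b \<le> 2 * width n - 3"
        using oct s(1,2) unfolding octagon_def x_def[symmetric] y_def[symmetric] by linarith
      \<comment> \<open>Dividing by 1 + \<i> leaves \<beta> (u + v \<i>), whose coordinates are half
        the sum and half the difference of 2 x - s and 2 y - s. Its sup norm thus bounds |x| + |y|
        from below.\<close>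
      have bound: "a \<le> \<bar>x\<bar> + \<bar>y\<bar> + s"
        if "a \<le> max \<bar>w\<bar> \<bar>z\<bar>" "2 * w = (2 * y - s) - (2 * x - s)" "2 * z = (2 * x - s) + (2 * y - s)" for w z
        using that s(1) by (auto simp: le_max_iff_disj)
      have "a \<le> max \<bar>b * u - a * - v\<bar> \<bar>b * - v + a * u\<bar>"
        using 3 by (intro odd_multiple_max_norm uv) auto
      moreover have "2 * (b * u - a * - v) = (2 * y - s) - (2 * x - s)"
        "2 * (b * - v + a * u) = (2 * x - s) + (2 * y - s)"
        unfolding xy by (simp_all add: algebra_simps)
      ultimately have "a \<le> \<bar>x\<bar> + \<bar>y\<bar> + s" by (rule bound)
      then have "a \<le> width (Suc n) - 2"
        using oct s(1,2) unfolding octagon_def x_def[symmetric] y_def[symmetric] by linarith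
      then show "octagon (Suc n) a b" using sup 3 by (simp add: octagon_def)
    qed
  qed
  then show ?thesis using assms by blast
qed

lemma covers_in_motzkin_imp_octagon: "covers (in_motzkin n) a b \<Longrightarrow> octagon (Suc n) a b"
  by (rule covers_imp_octagon) (use in_motzkin_octagon[of n] in \<open>unfold covers_def, blast\<close>)

lemma covers_imp_in_motzkin:
  assumes "covers (in_motzkin n) a b"
  shows "in_motzkin (Suc n) a b"
  using assms
proof (induction n arbitrary: a b rule: width.induct)
  case (1 a b)
  have "\<not> (even a \<and> even b)"
  proof
    assume ev: "even a \<and> even b"
    \<comment> \<open>For even \<beta>, every representative of 1 + \<i> has two odd coordinates,
      which \<open>octagon 0\<close> does not allow.\<close>
    obtain d e where de: "in_motzkin 0 (1 - (a * d - b * e)) (1 - (a * e + b * d))"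
      using 1 unfolding covers_def by blast
    have "1 - (a * d - b * e) \<noteq> 0" "1 - (a * e + b * d) \<noteq> 0"
      using ev by (metis dvd_diff dvd_add dvd_mult2 dvd_0_right odd_one dvd_diffD1 diff_eq_eq add_0)+
    moreover have "octagon 0 (1 - (a * d - b * e)) (1 - (a * e + b * d))" using de by (rule in_motzkin_octagon)
    ultimately show False unfolding octagon_def by simp linarith
  qed
  then show ?case using 1 covers_in_motzkin_imp_octagon in_motzkin_not_even by blast
next
  case (2 a b)
  show ?case
  proof (cases "even a \<and> even b")
    case True
    then obtain p q where pq: "a = 2 * p" "b = 2 * q" by (elim conjE evenE)
    \<comment> \<open>The only even element at index 1 is 0, so covering the residue of 2 means that
      2 \<gamma> divides 2; by norms, \<gamma> is a unit.\<close>
    obtain d e where "in_motzkin (Suc 0) (2 - (a * d - b * e)) (0 - (a * e + b * d))"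
      using 2 unfolding covers_def by blast
    then have "2 - (a * d - b * e) = 0" "0 - (a * e + b * d) = 0" using pq by (simp_all only: in_motzkin.simps) auto
    moreover have "a * d - b * e = 2 * (p * d - q * e)" "a * e + b * d = 2 * (p * e + q * d)"
      using pq by (simp_all add: algebra_simps)
    ultimately have "2 * (p * d - q * e) = 2" "2 * (p * e + q * d) = 0" by linarith+
    then have de: "p * d - q * e = 1" "p * e + q * d = 0" by (simp_all only: mult_eq_0_iff) simp_all
    have "(p * p + q * q) * (d * d + e * e) = (p * d - q * e) * (p * d - q * e) + (p * e + q * d) * (p * e + q * d)"
      by algebra
    then have "(p * p + q * q) * (d * d + e * e) = 1" unfolding de by simp
    then have "p * p + q * q dvd 1" by (metis dvd_triv_left)
    then have one: "p * p + q * q = 1" using sum_squares_ge_zero[of p q] by simp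
    have "\<bar>z\<bar> \<le> z * z" for z :: int
      using mult_left_mono[of 1 "\<bar>z\<bar>" "\<bar>z\<bar>"] by (cases "z = 0") auto
    from add_mono[OF this this, of p q] have "\<bar>p\<bar> + \<bar>q\<bar> \<le> 1" using one by simp
    moreover have "\<not> (even p \<and> even q)"
      using arg_cong[OF one, of even] by auto
    ultimately have "in_motzkin 0 p q" by (auto simp: octagon_def)
    then show ?thesis using pq by simp
  next
    case False
    then show ?thesis using 2 covers_in_motzkin_imp_octagon in_motzkin_not_even by blast
  qed
next
  case (3 n a b)
  show ?case
  proof (cases "even a \<and> even b")
    case True
    then obtain p q where pq: "a = 2 * p" "b = 2 * q" by (elim conjE evenE)
    \<comment> \<open>Even residues modulo 2 \<gamma> have only even representatives, and halving
      these lowers the index by two.\<close>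
    have "covers (in_motzkin n) p q" unfolding covers_def
    proof (intro allI)
      fix x y
      obtain d e where "in_motzkin (Suc (Suc n)) (2 * x - (a * d - b * e)) (2 * y - (a * e + b * d))"
        using 3(2) unfolding covers_def by blast
      moreover have "2 * x - (a * d - b * e) = 2 * (x - (p * d - q * e))"
        "2 * y - (a * e + b * d) = 2 * (y - (p * e + q * d))" using pq by (simp_all add: algebra_simps)
      ultimately have "in_motzkin n (x - (p * d - q * e)) (y - (p * e + q * d))" by simp
      then show "\<exists>d e. in_motzkin n (x - (p * d - q * e)) (y - (p * e + q * d))" by blast
    qed
    from 3(1)[OF this] show ?thesis using pq by simp
  next
    case False
    then show ?thesis using 3(2) covers_in_motzkin_imp_octagon in_motzkin_not_even by blast
  qed
qed

section \<open>Transfer to complex numbers\<close>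

definition gauss :: "int \<Rightarrow> int \<Rightarrow> complex" where
  "gauss x y = Complex (of_int x) (of_int y)"

lemma gauss_eq_iff [simp]: "gauss a b = gauss c d \<longleftrightarrow> a = c \<and> b = d"
  by (simp add: gauss_def complex_eq_iff)

lemma gauss_ints_iff: "z \<in> gauss_ints \<longleftrightarrow> (\<exists>x y. z = gauss x y)"
  by (auto simp: gauss_ints_def gauss_def complex_eq_iff Ints_def)

lemma gauss_diff_mult: "gauss x y - gauss u v = gauss a b * gauss d e \<longleftrightarrow>
    u = x - (a * d - b * e) \<and> v = y - (a * e + b * d)"
proof -
  have "gauss x y - gauss u v = gauss (x - u) (y - v)" "gauss a b * gauss d e = gauss (a * d - b * e) (a * e + b * d)"
    by (simp_all add: gauss_def complex_eq_iff)
  then show ?thesis by auto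
qed

lemma covers_residues_gauss:
  "covers_residues {gauss u v |u v. M u v} (gauss a b) \<longleftrightarrow> covers M a b"
proof -
  have "covers_residues {gauss u v |u v. M u v} (gauss a b) \<longleftrightarrow>
      (\<forall>x y. \<exists>u v. M u v \<and> (\<exists>d e. gauss x y - gauss u v = gauss a b * gauss d e))"
    unfolding covers_residues_iff Bex_def Ball_def gauss_ints_iff by blast
  then show ?thesis unfolding gauss_diff_mult covers_def by blast
qed

lemma motzkin_set_eq: "motzkin_set n = {gauss x y |x y. in_motzkin n x y}"
proof (induction n)
  case 0
  have "in_motzkin 0 x y \<longleftrightarrow> (x, y) \<in> {(0, 0), (1, 0), (-1, 0), (0, 1), (0, -1)}" for x y
    by (auto simp: octagon_def)
  moreover have "motzkin_set 0 = {gauss 0 0, gauss 1 0, gauss (-1) 0, gauss 0 1, gauss 0 (-1)}"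
    by (auto simp: gauss_def complex_eq_iff)
  ultimately show ?case by auto
next
  case (Suc n)
  have "in_motzkin (Suc n) a b \<longleftrightarrow> in_motzkin n a b \<or> covers (in_motzkin n) a b" for a b
    using in_motzkin_Suc[of n a b] in_motzkin_imp_covers[of n a b] covers_imp_in_motzkin[of n a b] in_motzkin_zero by blast
  moreover have "motzkin_set (Suc n) =
      {gauss x y |x y. in_motzkin n x y} \<union> {gauss a b |a b. covers (in_motzkin n) a b}"
    unfolding motzkin_set.simps Suc gauss_ints_iff by (auto simp: covers_residues_gauss)
  ultimately show ?case by blast
qed

lemma card_motzkin_set: "card (motzkin_set n) = card {(x, y). in_motzkin n x y}"
proof -
  have "motzkin_set n = (\<lambda>(x, y). gauss x y) ` {(x, y). in_motzkin n x y}"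
    unfolding motzkin_set_eq by auto
  then show ?thesis by (simp add: card_image inj_on_def)
qed

section \<open>Counting lattice points\<close>

definition truncated_square :: "int \<Rightarrow> int \<Rightarrow> (int \<times> int) set" where
  "truncated_square m k = {(x, y). \<bar>x\<bar> \<le> m \<and> \<bar>y\<bar> \<le> m \<and> \<bar>x\<bar> + \<bar>y\<bar> \<le> 2 * m - k}"

lemma finite_truncated_square [simp]: "finite (truncated_square m k)"
proof (rule finite_subset)
  show "truncated_square m k \<subseteq> {-m..m} \<times> {-m..m}" by (auto simp: truncated_square_def)
qed simp

text \<open>Raising k by one removes a diagonal of k + 1 points at each of the four corners. The
  bound by m keeps both coordinates on it nonzero, so their signs and |x| parametrize it
  injectively.\<close>

lemma card_truncated_square_nat:
  "int k \<le> m \<Longrightarrow> int (card (truncated_square m (int k))) = (2 * m + 1)\<^sup>2 - 2 * int k * (int k + 1)"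
proof (induction k)
  case 0
  then have "truncated_square m (int 0) = {-m..m} \<times> {-m..m}" by (auto simp: truncated_square_def)
  then show ?case using 0 by (simp add: card_cartesian_product power2_eq_square)
next
  case (Suc k)
  define D where "D = {(x, y). \<bar>x\<bar> \<le> m \<and> \<bar>y\<bar> \<le> m \<and> \<bar>x\<bar> + \<bar>y\<bar> = 2 * m - int k}"
  define f where "f = (\<lambda>(z, s, t). (s * z, t * (2 * m - int k - z)))"
  define A where "A = {m - int k..m} \<times> {-1, 1 :: int} \<times> {-1, 1 :: int}"
  have "D = f ` A"
  proof (intro equalityI subsetI)
    fix w assume "w \<in> D"
    then obtain x y where w: "w = (x, y)" "\<bar>x\<bar> \<le> m" "\<bar>y\<bar> \<le> m" "\<bar>x\<bar> + \<bar>y\<bar> = 2 * m - int k"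
      by (auto simp: D_def)
    then have "w = f (\<bar>x\<bar>, if x < 0 then -1 else 1, if y < 0 then -1 else 1)"
      by (auto simp: f_def)
    moreover have "(\<bar>x\<bar>, if x < 0 then -1 else 1, if y < 0 then -1 else 1) \<in> A"
      using w by (auto simp: A_def)
    ultimately show "w \<in> f ` A" by blast
  next
    fix w assume "w \<in> f ` A"
    then show "w \<in> D" using Suc.prems by (auto simp: f_def A_def D_def)
  qed
  moreover have "inj_on f A" using Suc.prems by (auto simp: inj_on_def f_def A_def)
  moreover have "int (card A) = 4 * (int k + 1)" by (simp add: A_def card_cartesian_product)
  ultimately have D: "int (card D) = 4 * (int k + 1)" "finite D"
    by (simp_all add: card_image A_def)
  have "truncated_square m (int k) = truncated_square m (int (Suc k)) \<union> D"
    "truncated_square m (int (Suc k)) \<inter> D = {}"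
    by (auto simp: truncated_square_def D_def)
  then have "card (truncated_square m (int k)) = card (truncated_square m (int (Suc k))) + card D"
    using D(2) by (simp add: card_Un_disjoint)
  then show ?case using Suc D by (simp add: algebra_simps)
qed

lemma card_truncated_square:
  assumes "0 \<le> k" "k \<le> m"
  shows "int (card (truncated_square m k)) = (2 * m + 1)\<^sup>2 - 2 * k * (k + 1)"
  using card_truncated_square_nat[of "nat k" m] assms by simp

lemma octagon_eq_truncated_square:
  "{(x, y). octagon n x y} = truncated_square (width n - 2) (2 * width n - width (Suc n) - 1)"
  by (auto simp: octagon_def truncated_square_def)

lemma card_in_motzkin_base:
  "int (card {(x, y). in_motzkin 0 x y}) = 5" "int (card {(x, y). in_motzkin (Suc 0) x y}) = 17"
proof -
  have "{(x, y). in_motzkin 0 x y} = {(x, y). octagon 0 x y}" by (auto simp: octagon_def)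
  then show "int (card {(x, y). in_motzkin 0 x y}) = 5"
    by (simp add: octagon_eq_truncated_square card_truncated_square)
  have oct: "octagon (Suc 0) x y \<longleftrightarrow> \<bar>x\<bar> \<le> 2 \<and> \<bar>y\<bar> \<le> 2 \<and> \<bar>x\<bar> + \<bar>y\<bar> \<le> 3" for x y
    unfolding octagon_def width.simps by simp
  \<comment> \<open>The nonzero even points of the octagon, the only ones excluded at index
    1.\<close>
  define C :: "(int \<times> int) set" where "C = {(2, 0), (-2, 0), (0, 2), (0, -2)}"
  have C: "card C = 4" "finite C" "C \<subseteq> {(x, y). octagon (Suc 0) x y}"
    by (auto simp: C_def oct)
  have "in_motzkin (Suc 0) x y \<longleftrightarrow> octagon (Suc 0) x y \<and> (x, y) \<notin> C" for x y
  proof (cases "even x \<and> even y")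
    case True
    then obtain p q where pq: "x = 2 * p" "y = 2 * q" by (elim conjE evenE)
    have "p = 0 \<and> q = 0 \<longleftrightarrow> \<bar>p\<bar> + \<bar>q\<bar> \<le> 1 \<and> (p, q) \<notin> {(1, 0), (-1, 0), (0, 1), (0, -1)}" by auto
    also have "\<dots> \<longleftrightarrow> octagon (Suc 0) x y \<and> (x, y) \<notin> C"
      by (auto simp: oct C_def pq abs_mult)
    finally show ?thesis by (simp add: pq)
  next
    case False
    then have "(x, y) \<notin> C" by (auto simp: C_def)
    then show ?thesis using False in_motzkin_not_even by blast
  qed
  then have "{(x, y). in_motzkin (Suc 0) x y} = {(x, y). octagon (Suc 0) x y} - C" by auto
  moreover have "int (card {(x, y). octagon (Suc 0) x y}) = 21"
    by (simp add: octagon_eq_truncated_square card_truncated_square numeral_eq_Suc)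
  ultimately show "int (card {(x, y). in_motzkin (Suc 0) x y}) = 17"
    using C by (simp add: card_Diff_subset)
qed

text \<open>Take the octagon, remove its even points, and put back the doubled set of index
  n.\<close>

lemma card_in_motzkin_Suc_Suc:
  fixes n :: nat and T :: int
  defines "T \<equiv> 2 ^ (n div 2)"
  shows "int (card {(x, y). in_motzkin (Suc (Suc n)) x y}) =
    int (card {(x, y). in_motzkin n x y}) + (4 * width n - 3)\<^sup>2 - (2 * width n - 1)\<^sup>2 - 24 * T\<^sup>2 + 12 * T"
proof -
  define double where "double = (\<lambda>(p :: int, q :: int). (2 * p, 2 * q))"
  define Oct where "Oct = {(x, y). octagon (Suc (Suc n)) x y}"
  \<comment> \<open>For doubled points the diagonal bound rounds down to |p| + |q| \<le>
    \<open>width (Suc n) - 2\<close>, which equals \<open>2 * (width n - 1) - 2 * T\<close>.\<close>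
  define Ev where "Ev = double ` truncated_square (width n - 1) (2 * T)"
  define Low where "Low = double ` {(x, y). in_motzkin n x y}"
  have T: "1 \<le> T" by (simp add: T_def)
  have w: "2 * width n - width (Suc n) = 2 * T" "3 * T \<le> width n"
    by (cases rule: width_cases[of n]; simp add: T_def)+
  have inj: "inj_on double X" for X by (auto simp: double_def inj_on_def)
  have Ev: "(x, y) \<in> Ev \<longleftrightarrow> (x, y) \<in> Oct \<and> even x \<and> even y" for x y
  proof (cases "even x \<and> even y")
    case True
    then obtain p q where pq: "x = 2 * p" "y = 2 * q" by (elim conjE evenE)
    have "(x, y) \<in> Ev \<longleftrightarrow> (p, q) \<in> truncated_square (width n - 1) (2 * T)"
      by (auto simp: Ev_def double_def pq)
    also have "\<dots> \<longleftrightarrow> (x, y) \<in> Oct"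
      using w(1) by (auto simp: truncated_square_def Oct_def octagon_def pq abs_mult)
    finally show ?thesis using True by simp
  next
    case False
    then show ?thesis by (auto simp: Ev_def double_def)
  qed
  have Low: "(x, y) \<in> Low \<longleftrightarrow> even x \<and> even y \<and> in_motzkin n (x div 2) (y div 2)" for x y
  proof (cases "even x \<and> even y")
    case True
    then obtain p q where "x = 2 * p" "y = 2 * q" by (elim conjE evenE)
    then show ?thesis by (auto simp: Low_def double_def)
  next
    case False
    then show ?thesis by (auto simp: Low_def double_def)
  qed
  have Oct_eq: "Oct = truncated_square (2 * width n - 2) (4 * T - 1)"
    using w(1) unfolding Oct_def octagon_eq_truncated_square by (auto simp: algebra_simps)
  have fin: "finite Oct" "finite Ev" by (simp_all add: Oct_eq Ev_def)
  have "{(x, y). in_motzkin n x y} \<subseteq> {(x, y). octagon n x y}" using in_motzkin_octagon by auto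
  then have "finite {(x, y). in_motzkin n x y}"
    by (rule finite_subset) (simp add: octagon_eq_truncated_square)
  then have fin_Low: "finite Low" by (simp add: Low_def)
  have "Ev \<subseteq> Oct" using Ev by auto
  have "{(x, y). in_motzkin (Suc (Suc n)) x y} = (Oct - Ev) \<union> Low"
    using Ev Low by (auto simp: Oct_def)
  moreover have "(Oct - Ev) \<inter> Low = {}" using Ev Low by auto
  ultimately have "card {(x, y). in_motzkin (Suc (Suc n)) x y} = card (Oct - Ev) + card Low"
    using fin fin_Low by (simp add: card_Un_disjoint)
  also have "int \<dots> = int (card Oct) - int (card Ev) + int (card Low)"
    using card_mono[OF fin(1) \<open>Ev \<subseteq> Oct\<close>] \<open>Ev \<subseteq> Oct\<close> fin
    by (simp only: card_Diff_subset of_nat_add of_nat_diff)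
  also have "card Low = card {(x, y). in_motzkin n x y}" by (simp add: Low_def card_image inj)
  also have "int (card Ev) = (2 * width n - 1)\<^sup>2 - 4 * T * (2 * T + 1)"
    using T w(2) by (simp add: Ev_def card_image inj card_truncated_square)
  also have "int (card Oct) = (4 * width n - 3)\<^sup>2 - 8 * T * (4 * T - 1)"
    using T w(2) by (simp add: Oct_eq card_truncated_square)
  finally show ?thesis by (simp add: power2_eq_square algebra_simps)
qed

lemma card_in_motzkin_odd:
  "int (card {(x, y). in_motzkin (2 * k + 1) x y}) = 14 * 4 ^ (k + 1) - 34 * 2 ^ (k + 1) + 8 * int k + 29"
proof (induction k)
  case 0
  then show ?case using card_in_motzkin_base by simp
next
  case (Suc k)
  have "(4::int) ^ k = 2 ^ k * 2 ^ k" by (simp add: power_mult_distrib[symmetric])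
  then show ?case using Suc card_in_motzkin_Suc_Suc[of "2 * k + 1"]
    by (simp add: width_div power2_eq_square algebra_simps)
qed

lemma card_in_motzkin_even:
  "int (card {(x, y). in_motzkin (2 * k) x y}) = 28 * 4 ^ k - 48 * 2 ^ k + 8 * int k + 25"
proof (induction k)
  case 0
  then show ?case using card_in_motzkin_base by simp
next
  case (Suc k)
  have "(4::int) ^ k = 2 ^ k * 2 ^ k" by (simp add: power_mult_distrib[symmetric])
  then show ?case using Suc card_in_motzkin_Suc_Suc[of "2 * k"]
    by (simp add: width_div power2_eq_square algebra_simps)
qed

theorem theorem4p3:
  shows "(\<forall>k::nat. int (card (motzkin_set (2 * k + 1)))
             = 14 * 4 ^ (k + 1) - 34 * 2 ^ (k + 1) + 8 * int k + 29) \<and>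
         (\<forall>k::nat. k \<ge> 1 \<longrightarrow> int (card (motzkin_set (2 * k)))
             = 28 * 4 ^ k - 48 * 2 ^ k + 8 * int k + 25)"
  by (simp only: card_motzkin_set card_in_motzkin_odd card_in_motzkin_even simp_thms)

end
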